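(* For every $k \in \mathbb{N}$, we have $$\operatorname{lcm}\left\{\binom{k}{0}, \binom{k}{1}, \dots, \binom{k}{k}\right\} = \frac{\operatorname{lcm}(1, 2, \dots, k, k+1)}{k+1}.$$
   Context: $\mathbb{N}$ denotes the set of natural numbers including $0$. $\operatorname{lcm}$ denotes the (positive) least common multiple of a finite collection of positive integers. *)

theory Defs
  imports Complex_Main
begin

end

theory Submission
  imports Defs
begin

text \<open>
  Both divisibilities rest on the entries \<open>(n + 1) * (n choose m)\<close> of the inverted Leibniz harmonic
  triangle. Since \<open>m + 1\<close> divides \<open>(n + 1) * (n choose m) = (m + 1) * (Suc n choose Suc m)\<close>,
  the number \<open>lcm (1, \<dots>, k + 1)\<close> divides \<open>k + 1\<close> times the lcm of the binomial coefficients.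
  Conversely, the reciprocals of the entries satisfy a difference recurrence starting from
  \<open>1 / (n + 1)\<close>, so by induction on \<open>m\<close> each is an integer combination of
  \<open>1, 1/2, \<dots>, 1/(n + 1)\<close>; hence every entry divides \<open>lcm (1, \<dots>, n + 1)\<close>.
\<close>

lemma leibniz_triangle_recurrence:
  assumes "m \<le> n"
  shows "1 / (real (n + 2) * real (Suc n choose Suc m)) =
         1 / (real (n + 1) * real (n choose m)) - 1 / (real (n + 2) * real (Suc n choose m))"
proof -
  obtain d where n: "n = m + d"
    using assms le_Suc_ex by blast
  define A where "A = real (n choose m)"
  have A: "A > 0"
    using assms by (simp add: A_def)
  have "Suc m * (Suc n choose Suc m) = Suc n * (n choose m)"
    by (simp only: Suc_times_binomial_eq mult.commute)
  then have "real (m + 1) * real (Suc n choose Suc m) = real (n + 1) * A"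
    unfolding A_def Suc_eq_plus1 by (metis of_nat_mult)
  then have 1: "real (Suc n choose Suc m) = real (n + 1) * A / real (m + 1)"
    by (simp add: field_simps del: binomial_Suc_Suc)
  have "(Suc n - m) * (Suc n choose m) = Suc n * (n choose m)"
    using binomial_absorb_comp[of "Suc n" m] by simp
  then have "Suc d * (Suc n choose m) = Suc n * (n choose m)"
    by (simp add: n Suc_diff_le)
  then have "real (d + 1) * real (Suc n choose m) = real (n + 1) * A"
    unfolding A_def Suc_eq_plus1 by (metis of_nat_mult)
  then have 2: "real (Suc n choose m) = real (n + 1) * A / real (d + 1)"
    by (simp add: field_simps)
  \<comment> \<open>Once all three entries are written through \<open>A\<close>, the recurrence
    reduces to n + 2 = (m + 1) + (d + 1), that is \<open>y = x + w\<close>.\<close>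
  have "x / (y * (z * A)) = 1 / (z * A) - w / (y * (z * A))"
    if "y = x + w" "y > 0" "z > 0" for x y z w :: real
  proof -
    have "1 / (z * A) = y / (y * (z * A))"
      using that by simp
    then show ?thesis
      by (simp only: diff_divide_distrib[symmetric] \<open>y = x + w\<close> add_diff_cancel_right')
  qed
  from this[of "real (n + 2)" "real (m + 1)" "real (d + 1)" "real (n + 1)"]
  show ?thesis
    unfolding 1 2 A_def[symmetric] by (simp add: n)
qed

text \<open>Taking any common multiple \<open>N\<close>, not the lcm of one row, lets the same
  \<open>N\<close> serve all rows in the induction.\<close>

lemma Suc_times_binomial_dvd:
  assumes "m \<le> n" and "\<And>j. 1 \<le> j \<Longrightarrow> j \<le> Suc n \<Longrightarrow> j dvd N"
  shows "Suc n * (n choose m) dvd N"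
proof -
  \<comment> \<open>Divisibility becomes integrality of a quotient because the recurrence is linear
    in the reciprocals.\<close>
  have "real N * (1 / (real (n + 1) * real (n choose m))) \<in> \<int>"
    using assms
  proof (induction m arbitrary: n)
    case 0
    then have "Suc n dvd N"
      by simp
    then obtain q where "N = Suc n * q" ..
    then have "real N * (1 / (real (n + 1) * real (n choose 0))) = real q"
      by (simp del: of_nat_Suc mult_Suc)
    then show ?case
      by (metis Ints_of_nat)
  next
    case (Suc m)
    then obtain n' where n: "n = Suc n'" and m: "m \<le> n'"
      by (cases n) auto
    \<comment> \<open>The recurrence draws on column \<open>m\<close> in rows \<open>n'\<close> and
      \<open>n\<close>; the divisors required for row \<open>n'\<close> are among those for row
      \<open>n\<close>.\<close>
    have "real N * (1 / (real (n' + 1) * real (n' choose m))) \<in> \<int>"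
         "real N * (1 / (real (n + 1) * real (n choose m))) \<in> \<int>"
      using Suc.prems m by (intro Suc.IH; simp add: n)+
    from Ints_diff[OF this] show ?case
      using leibniz_triangle_recurrence[OF m]
      by (simp add: n right_diff_distrib del: binomial_Suc_Suc)
  qed
  then have "real N / real (Suc n * (n choose m)) \<in> \<int>"
    by (simp only: of_nat_mult Suc_eq_plus1 times_divide_eq_right mult_1_right)
  then obtain z :: int where z: "real N / real (Suc n * (n choose m)) = of_int z"
    by (auto elim: Ints_cases)
  have "real (Suc n * (n choose m)) \<noteq> 0"
    using assms(1) by (simp only: of_nat_eq_0_iff) simp
  then have "real N = of_int z * real (Suc n * (n choose m))"
    using z by (metis nonzero_divide_eq_eq)
  then have "int N = z * int (Suc n * (n choose m))"
    by (metis of_int_eq_iff of_int_mult of_int_of_nat_eq)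
  then show ?thesis
    by (metis dvd_triv_right int_dvd_int_iff)
qed

lemma Suc_times_Lcm_binomial:
  "Suc k * Lcm {k choose i | i. i \<le> k} = Lcm {1..Suc k}"
proof (rule dvd_antisym)
  \<comment> \<open>Splitting off \<open>Suc k\<close> leaves a quotient \<open>q\<close> that each
    binomial coefficient divides after cancellation, so their lcm does too.\<close>
  have "Suc k dvd Lcm {1..Suc k}"
    by (rule dvd_Lcm) simp
  then obtain q where q: "Lcm {1..Suc k} = Suc k * q" ..
  have "(k choose i) dvd q" if "i \<le> k" for i
  proof -
    have "Suc k * (k choose i) dvd Suc k * q"
      unfolding q[symmetric] using that by (intro Suc_times_binomial_dvd) auto
    then show ?thesis
      using dvd_times_left_cancel_iff[of "Suc k"] by blast
  qed
  then have "Lcm {k choose i | i. i \<le> k} dvd q"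
    by (auto intro: Lcm_least)
  then show "Suc k * Lcm {k choose i | i. i \<le> k} dvd Lcm {1..Suc k}"
    unfolding q by (rule mult_dvd_mono[OF dvd_refl])
next
  show "Lcm {1..Suc k} dvd Suc k * Lcm {k choose i | i. i \<le> k}"
  proof (rule Lcm_least)
    fix j assume "j \<in> {1..Suc k}"
    then obtain i where j: "j = Suc i" and i: "i \<le> k"
      by (cases j) auto
    have "j dvd Suc k * (k choose i)"
      unfolding Suc_times_binomial_eq j by (rule dvd_triv_right)
    also have "\<dots> dvd Suc k * Lcm {k choose i | i. i \<le> k}"
      using i by (intro mult_dvd_mono dvd_refl dvd_Lcm) auto
    finally show "j dvd Suc k * Lcm {k choose i | i. i \<le> k}" .
  qed
qed

theorem theorem1:
  fixes k :: nat
  shows "real (Lcm {k choose i | i. i \<le> k}) = real (Lcm {1..k + 1}) / real (k + 1)"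
  unfolding Suc_eq_plus1[symmetric] Suc_times_Lcm_binomial[symmetric]
  by (simp del: of_nat_Suc mult_Suc)

end
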